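(* Let $f(a,x,y)$ be a three-variable analytic function in a neighborhood of $(a,x,y)=(0,0,0)\in\mathbb{C}^3$. Then $f(a,x,y)$ can be expanded in terms of the generalized Cauchy polynomials $p_n(x,y,a)$, that is, $f(a,x,y)=\sum_{n=0}^\infty \mu_n\,p_n(x,y,a)$ with coefficients $\mu_n$ not depending on $x$ and $y$, if and only if $$x\big[f(a,x,y)-f(a,x,qy)\big]=y\big[f(a,qx,qy)-f(a,x,qy)\big]-ay\big[f(a,qx,q^2y)-f(a,x,q^2y)\big].$$
   Context: $q$ is a fixed complex number with $|q|<1$. The $q$-shifted factorial is $(a;q)_0=1$, $(a;q)_n=\prod_{i=0}^{n-1}(1-aq^i)$ for $n\ge 1$. The $q$-binomial coefficient is $\binom{n}{k}_q=\frac{(q;q)_n}{(q;q)_k(q;q)_{n-k}}$ for $0\le k\le n$ and $0$ otherwise. The generalized Cauchy polynomials are $$p_n(x,y,a)=\sum_{k=0}^n \binom{n}{k}_q(-1)^k q^{k(k-1)/2}(a;q)_k\,x^{n-k}y^k .$$ The coefficients $\mu_n$ in an expansion may depend on $a$. The expansion and the functional equation are understood for $(a,x,y)$ in a neighborhood of the origin. *)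

theory Defs
  imports "HOL-Analysis.Analysis"
begin

definition qpoch :: "complex \<Rightarrow> complex \<Rightarrow> nat \<Rightarrow> complex" where
  "qpoch a q n = (\<Prod>i<n. 1 - a * q ^ i)"

definition qbinom :: "complex \<Rightarrow> nat \<Rightarrow> nat \<Rightarrow> complex" where
  "qbinom q n k =
     (if k \<le> n then qpoch q q n / (qpoch q q k * qpoch q q (n - k)) else 0)"

definition gen_cauchy_poly ::
    "complex \<Rightarrow> nat \<Rightarrow> complex \<Rightarrow> complex \<Rightarrow> complex \<Rightarrow> complex" where
  "gen_cauchy_poly q n x y a =
     (\<Sum>k\<le>n. qbinom q n k * (-1) ^ k * q ^ (k * (k - 1) div 2) * qpoch a q k * x ^ (n - k) * y ^ k)"

text \<open>
  Analyticity in three complex variables: around each point of the set, the function is the sum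
  of a power series in three variables on some polydisc. Summability over the triples of
  exponents is unconditional, i.e. absolute. The library's \<open>analytic_on\<close> only covers
  functions of one complex variable.
\<close>

definition analytic3_on ::
    "(complex \<times> complex \<times> complex \<Rightarrow> complex) \<Rightarrow> (complex \<times> complex \<times> complex) set \<Rightarrow> bool" where
  "analytic3_on f S \<longleftrightarrow>
     (\<forall>(a0, x0, y0) \<in> S. \<exists>(c :: nat \<Rightarrow> nat \<Rightarrow> nat \<Rightarrow> complex) (r :: real). r > 0 \<and>
        (\<forall>a \<in> ball a0 r. \<forall>x \<in> ball x0 r. \<forall>y \<in> ball y0 r.
           ((\<lambda>(i, j, k). c i j k * (a - a0) ^ i * (x - x0) ^ j * (y - y0) ^ k)
              has_sum f (a, x, y)) UNIV))"

end

theory Submission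
  imports Defs "HOL-Complex_Analysis.Cauchy_Integral_Formula"
begin

text \<open>
  Fix \<open>a\<close> and write \<open>f(a,x,y) = \<Sum> A\<^sub>j\<^sub>k x\<^sup>j y\<^sup>k\<close>.  Replacing \<open>x\<close>, \<open>y\<close> by \<open>q\<close>-multiples acts diagonally on
  monomials, so comparing coefficients of \<open>x\<^sup>j\<^sup>+\<^sup>1 y\<^sup>k\<^sup>+\<^sup>1\<close> turns the functional equation into a two-term
  recurrence that expresses \<open>A\<close> at \<open>(j, k + 1)\<close> by \<open>A\<close> at \<open>(j + 1, k)\<close>.  It stays within one total
  degree \<open>n = j + k\<close>, and since \<open>1 - q ^ (k + 1) \<noteq> 0\<close> it determines the whole homogeneous part of
  degree \<open>n\<close> from its coefficient of \<open>x\<^sup>n\<close>.  The coefficients of \<open>gen_cauchy_poly q n\<close>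
  satisfy the same recurrence (\<open>cauchy_coeff_Suc\<close>) and that polynomial has leading coefficient \<open>1\<close> in \<open>x\<close>.
  Hence the homogeneous part of degree \<open>n\<close> is the multiple of the Cauchy polynomial by the
  coefficient of \<open>x\<^sup>n\<close>; this coefficient serves as \<open>\<mu> n a\<close>.

  Conversely the recurrence says that each Cauchy polynomial solves the functional equation
  (\<open>gen_cauchy_poly_functional_equation\<close>).  The equation is linear and only evaluates \<open>f\<close> at points
  with the same \<open>a\<close>, so it passes to the sum of any pointwise convergent expansion.  Absolute convergence of the power
  series enters where coefficients are compared (\<open>double_power_series_zero\<close>) and where terms are
  regrouped by degree (\<open>has_sum_group_by_degree\<close>).
\<close>

section \<open>The Cauchy polynomials\<close>

definition cauchy_coeff :: "complex \<Rightarrow> complex \<Rightarrow> nat \<Rightarrow> nat \<Rightarrow> complex" where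
  "cauchy_coeff q a n k = qbinom q n k * (-1) ^ k * q ^ (k * (k - 1) div 2) * qpoch a q k"

lemma gen_cauchy_poly_eq:
  "gen_cauchy_poly q n x y a = (\<Sum>k\<le>n. cauchy_coeff q a n k * x ^ (n - k) * y ^ k)"
  by (simp add: gen_cauchy_poly_def cauchy_coeff_def)

lemma one_minus_power_Suc_nonzero:
  fixes q :: complex
  assumes "norm q < 1"
  shows "1 - q ^ Suc k \<noteq> 0"
proof
  assume "1 - q ^ Suc k = 0"
  then have "norm (q ^ Suc k) = 1" by simp
  then have "norm q ^ Suc k = 1" by (simp only: norm_power)
  moreover have "norm q ^ Suc k < 1"
    using power_decreasing[of 1 "Suc k" "norm q"] assms by simp
  ultimately show False by simp
qed

lemma qpoch_q_nonzero:
  assumes "norm q < 1"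
  shows "qpoch q q n \<noteq> 0"
  using one_minus_power_Suc_nonzero[OF assms] by (simp add: qpoch_def)

lemma qpoch_0 [simp]: "qpoch a q 0 = 1"
  by (simp add: qpoch_def)

lemma qpoch_Suc: "qpoch a q (Suc n) = qpoch a q n * (1 - a * q ^ n)"
  by (simp add: qpoch_def)

lemma cauchy_coeff_0:
  assumes "norm q < 1"
  shows "cauchy_coeff q a n 0 = 1"
  using qpoch_q_nonzero[OF assms] by (simp add: cauchy_coeff_def qbinom_def)

text \<open>
  Passing from \<open>k\<close> to \<open>k + 1\<close> removes the factor \<open>1 - q ^ (n - k)\<close> from one \<open>q\<close>-factorial in the
  denominator of the \<open>q\<close>-binomial and adds the factor \<open>1 - q ^ (k + 1)\<close> to the other, and the
  triangular exponent grows by \<open>k\<close>.  With \<open>n = j + k + 1\<close> the two monomials involved are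
  \<open>x\<^sup>j y\<^sup>k\<^sup>+\<^sup>1\<close> and \<open>x\<^sup>j\<^sup>+\<^sup>1 y\<^sup>k\<close>.
\<close>
lemma cauchy_coeff_Suc:
  assumes "norm q < 1"
  shows "cauchy_coeff q a (Suc (j + k)) (Suc k) * (1 - q ^ Suc k) =
           cauchy_coeff q a (Suc (j + k)) k * q ^ k * (q ^ Suc j - 1) * (1 - a * q ^ k)"
proof -
  have tri: "Suc k * (Suc k - 1) div 2 = k * (k - 1) div 2 + k"
  proof -
    have "Suc k * (Suc k - 1) = k * (k - 1) + k * 2"
      by (cases k) auto
    then show ?thesis by simp
  qed
  have nz: "qpoch q q k \<noteq> 0" "qpoch q q j \<noteq> 0" "1 - q * q ^ k \<noteq> 0" "1 - q * q ^ j \<noteq> 0"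
    using qpoch_q_nonzero[OF assms] one_minus_power_Suc_nonzero[OF assms] by auto
  have binom: "qbinom q (Suc (j + k)) (Suc k) * (1 - q ^ Suc k) =
                 qbinom q (Suc (j + k)) k * (1 - q ^ Suc j)"
  proof -
    have "Suc (j + k) - Suc k = j" "Suc (j + k) - k = Suc j" by auto
    then show ?thesis
      using nz by (simp add: qbinom_def qpoch_Suc[of q q k] qpoch_Suc[of q q j])
  qed
  have "cauchy_coeff q a (Suc (j + k)) (Suc k) * (1 - q ^ Suc k) =
          (qbinom q (Suc (j + k)) (Suc k) * (1 - q ^ Suc k)) *
          (- ((-1) ^ k)) * q ^ (k * (k - 1) div 2) * q ^ k * qpoch a q k * (1 - a * q ^ k)"
    unfolding cauchy_coeff_def tri by (simp add: power_add qpoch_Suc)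
  also have "\<dots> = cauchy_coeff q a (Suc (j + k)) k * q ^ k * (q ^ Suc j - 1) * (1 - a * q ^ k)"
    unfolding binom cauchy_coeff_def by (simp add: algebra_simps)
  finally show ?thesis .
qed

text \<open>
  The left side annihilates the term \<open>k = 0\<close> and the right side the term \<open>k = n\<close>; after shifting
  the left sum by one, the terms agree one by one by the recurrence of the coefficients.
\<close>
lemma gen_cauchy_poly_functional_equation:
  assumes "norm q < 1"
  defines "p \<equiv> \<lambda>n x y a. gen_cauchy_poly q n x y a"
  shows "x * (p n x y a - p n x (q * y) a) =
           y * (p n (q * x) (q * y) a - p n x (q * y) a)
           - a * y * (p n (q * x) (q\<^sup>2 * y) a - p n x (q\<^sup>2 * y) a)"
proof (cases n)
  case 0
  then show ?thesis by (simp add: p_def gen_cauchy_poly_eq)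
next
  case (Suc m)
  define C where "C = cauchy_coeff q a n"
  have "x * (p n x y a - p n x (q * y) a) =
          (\<Sum>k\<le>Suc m. C k * (1 - q ^ k) * x ^ Suc (n - k) * y ^ k)"
    unfolding p_def gen_cauchy_poly_eq C_def[symmetric] Suc[symmetric]
    by (simp add: sum_distrib_left sum_subtractf[symmetric] power_mult_distrib algebra_simps)
  also have "\<dots> = (\<Sum>k\<le>m. C (Suc k) * (1 - q ^ Suc k) * x ^ Suc (n - Suc k) * y ^ Suc k)"
    by (subst sum.atMost_Suc_shift) simp
  also have "\<dots> = (\<Sum>k\<le>m. C k * q ^ k * (q ^ (n - k) - 1) * (1 - a * q ^ k) * x ^ (n - k) * y ^ Suc k)"
  proof (intro sum.cong refl)
    fix k assume "k \<in> {..m}"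
    then have n: "n = Suc ((m - k) + k)" and nk: "n - k = Suc (m - k)" "Suc (n - Suc k) = Suc (m - k)"
      using Suc by auto
    show "C (Suc k) * (1 - q ^ Suc k) * x ^ Suc (n - Suc k) * y ^ Suc k =
            C k * q ^ k * (q ^ (n - k) - 1) * (1 - a * q ^ k) * x ^ (n - k) * y ^ Suc k"
      using cauchy_coeff_Suc[OF assms(1), of a "m - k" k]
      unfolding nk C_def n[symmetric] by simp
  qed
  also have "\<dots> = (\<Sum>k\<le>n. C k * q ^ k * (q ^ (n - k) - 1) * (1 - a * q ^ k) * x ^ (n - k) * y ^ Suc k)"
    unfolding Suc by simp
  also have "\<dots> = y * (p n (q * x) (q * y) a - p n x (q * y) a)
           - a * y * (p n (q * x) (q\<^sup>2 * y) a - p n x (q\<^sup>2 * y) a)"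
    unfolding p_def gen_cauchy_poly_eq C_def[symmetric]
    by (simp add: sum_distrib_left sum_subtractf[symmetric] power_mult_distrib power2_eq_square
        algebra_simps)
  finally show ?thesis .
qed

section \<open>Double power series\<close>

lemma power_series_zero:
  fixes b :: "nat \<Rightarrow> complex"
  assumes "s > 0" and sums0: "\<And>z. norm z < s \<Longrightarrow> (\<lambda>n. b n * z ^ n) sums 0"
  shows "b n = 0"
proof (cases "n = 0")
  case True
  then show ?thesis using sums0[of 0] assms(1) by simp
next
  case False
  show ?thesis
  proof (rule ccontr)
    assume "b n \<noteq> 0"
    then obtain d where "d > 0" and d: "\<And>z::complex. z \<in> cball 0 d - {0} \<Longrightarrow> (0::complex) \<noteq> 0"
      using powser_0_nonzero[of s 0 b "\<lambda>_. 0" n] assms False by auto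
    show False using d[of "of_real d"] \<open>d > 0\<close> by simp
  qed
qed

text \<open>
  For fixed \<open>x\<close> the sum over \<open>j\<close> gives the coefficient of \<open>y\<^sup>k\<close> in a vanishing power series in \<open>y\<close>, and
  as a function of \<open>x\<close> this coefficient is itself a vanishing power series.  Taking \<open>y\<close>
  nonzero shows that the inner series converge.
\<close>
lemma double_power_series_zero:
  fixes B :: "nat \<Rightarrow> nat \<Rightarrow> complex"
  assumes s: "s > 0"
    and zero: "\<And>x y. norm x < s \<Longrightarrow> norm y < s \<Longrightarrow>
                 ((\<lambda>(j, k). B j k * x ^ j * y ^ k) has_sum 0) UNIV"
  shows "B j k = 0"
proof -
  have inner: "(\<lambda>j. B j k * x ^ j) summable_on UNIV" if x: "norm x < s" for x k
  proof -
    define y :: complex where "y = of_real (s / 2)"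
    have y: "norm y < s" "y \<noteq> 0" using s by (auto simp: y_def)
    have "(\<lambda>(k, j). B j k * x ^ j * y ^ k) summable_on UNIV \<times> UNIV"
      using has_sum_imp_summable[OF zero[OF x y(1)]]
      by (subst summable_on_reindex_bij_witness[where i = prod.swap and j = prod.swap]) auto
    then have "(\<lambda>j. B j k * x ^ j * y ^ k) summable_on UNIV"
      by (rule summable_on_SigmaD1) simp
    then show ?thesis
      using y by (simp add: summable_on_cmult_left')
  qed
  have slice: "infsum (\<lambda>j. B j k * x ^ j) UNIV = 0" if x: "norm x < s" for x k
  proof (rule power_series_zero[OF s, of "\<lambda>k. infsum (\<lambda>j. B j k * x ^ j) UNIV"])
    fix y :: complex assume y: "norm y < s"
    have total: "((\<lambda>(k, j). B j k * x ^ j * y ^ k) has_sum 0) (UNIV \<times> UNIV)"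
      using zero[OF x y]
      by (subst has_sum_reindex_bij_witness[where i = prod.swap and j = prod.swap and T = UNIV
            and h = "\<lambda>(j, k). B j k * x ^ j * y ^ k"]) auto
    have rows: "((\<lambda>j. B j k * x ^ j * y ^ k) has_sum (infsum (\<lambda>j. B j k * x ^ j) UNIV * y ^ k)) UNIV"
      for k
      by (intro has_sum_cmult_left has_sum_infsum inner x)
    have "((\<lambda>k. infsum (\<lambda>j. B j k * x ^ j) UNIV * y ^ k) has_sum 0) UNIV"
      by (rule has_sum_SigmaD[OF total]) (simp add: rows)
    then show "(\<lambda>k. infsum (\<lambda>j. B j k * x ^ j) UNIV * y ^ k) sums 0"
      by (rule has_sum_imp_sums)
  qed
  show ?thesis
  proof (rule power_series_zero[OF s, of "\<lambda>j. B j k"])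
    fix x :: complex assume x: "norm x < s"
    show "(\<lambda>j. B j k * x ^ j) sums 0"
      using has_sum_infsum[OF inner[OF x, of k]] slice[OF x, of k] by (auto intro: has_sum_imp_sums)
  qed
qed

lemma has_sum_diff:
  fixes f g :: "'a \<Rightarrow> complex"
  assumes "(f has_sum S) A" and "(g has_sum T) A"
  shows "((\<lambda>x. f x - g x) has_sum S - T) A"
  using has_sum_add[OF assms(1), of "\<lambda>x. - g x" "- T"] assms(2) by (simp add: has_sum_uminus)

lemma has_sum_times_x:
  fixes A :: "nat \<Rightarrow> nat \<Rightarrow> complex"
  assumes "((\<lambda>(j, k). A j k * x ^ j * y ^ k) has_sum S) UNIV"
  shows "((\<lambda>(j, k). (case j of 0 \<Rightarrow> 0 | Suc i \<Rightarrow> A i k) * x ^ j * y ^ k) has_sum x * S) UNIV"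
proof -
  let ?g = "\<lambda>(j, k). (case j of 0 \<Rightarrow> 0 | Suc i \<Rightarrow> A i k) * x ^ j * y ^ k"
  have "((\<lambda>(j, k). x * (A j k * x ^ j * y ^ k)) has_sum x * S) UNIV"
    using has_sum_cmult_right[OF assms, of x] by (simp add: case_prod_unfold)
  also have "?this \<longleftrightarrow> (?g has_sum x * S) {(j, k). j \<noteq> 0}"
    by (rule has_sum_reindex_bij_witness[where i = "\<lambda>(j, k). (j - 1, k)" and j = "\<lambda>(j, k). (Suc j, k)"])
      auto
  also have "\<dots> \<longleftrightarrow> (?g has_sum x * S) UNIV"
    by (rule has_sum_cong_neutral) (auto split: nat.splits)
  finally show ?thesis .
qed

lemma has_sum_times_y:
  fixes A :: "nat \<Rightarrow> nat \<Rightarrow> complex"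
  assumes "((\<lambda>(j, k). A j k * x ^ j * y ^ k) has_sum S) UNIV"
  shows "((\<lambda>(j, k). (case k of 0 \<Rightarrow> 0 | Suc i \<Rightarrow> A j i) * x ^ j * y ^ k) has_sum y * S) UNIV"
proof -
  let ?g = "\<lambda>(j, k). (case k of 0 \<Rightarrow> 0 | Suc i \<Rightarrow> A j i) * x ^ j * y ^ k"
  have "((\<lambda>(j, k). y * (A j k * x ^ j * y ^ k)) has_sum y * S) UNIV"
    using has_sum_cmult_right[OF assms, of y] by (simp add: case_prod_unfold)
  also have "?this \<longleftrightarrow> (?g has_sum y * S) {(j, k). k \<noteq> 0}"
    by (rule has_sum_reindex_bij_witness[where i = "\<lambda>(j, k). (j, k - 1)" and j = "\<lambda>(j, k). (j, Suc k)"])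
      auto
  also have "\<dots> \<longleftrightarrow> (?g has_sum y * S) UNIV"
    by (rule has_sum_cong_neutral) (auto split: nat.splits)
  finally show ?thesis .
qed

lemma has_sum_group_by_degree:
  fixes g :: "nat \<Rightarrow> nat \<Rightarrow> complex"
  assumes "((\<lambda>(j, k). g j k) has_sum S) UNIV"
  shows "(\<lambda>n. \<Sum>k\<le>n. g (n - k) k) sums S"
proof -
  have "((\<lambda>(n, k). g (n - k) k) has_sum S) (SIGMA n:UNIV. {..n})"
    using assms
    by (subst has_sum_reindex_bij_witness[where i = "\<lambda>(j, k). (j + k, k)" and j = "\<lambda>(n, k). (n - k, k)"
          and h = "\<lambda>(j, k). g j k" and T = UNIV]) auto
  then have "((\<lambda>n. \<Sum>k\<le>n. g (n - k) k) has_sum S) UNIV"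
    by (rule has_sum_SigmaD) (auto intro: has_sum_finiteI)
  then show ?thesis by (rule has_sum_imp_sums)
qed

text \<open>
  Freezing \<open>a\<close> turns a triple power series into a double one.  Convergence of the series in \<open>a\<close>
  that form the new coefficients is read off at nonzero \<open>x\<close> and \<open>y\<close>.
\<close>
lemma triple_power_series_slice:
  fixes c :: "nat \<Rightarrow> nat \<Rightarrow> nat \<Rightarrow> complex"
  assumes r: "r > 0" and a: "norm a < r"
    and F: "\<And>x y. norm x < r \<Longrightarrow> norm y < r \<Longrightarrow>
              ((\<lambda>(i, j, k). c i j k * a ^ i * x ^ j * y ^ k) has_sum F x y) UNIV"
    and x: "norm x < r" and y: "norm y < r"
  shows "((\<lambda>(j, k). infsum (\<lambda>i. c i j k * a ^ i) UNIV * x ^ j * y ^ k) has_sum F x y) UNIV"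
proof -
  have swapped: "((\<lambda>((j, k), i). c i j k * a ^ i * x ^ j * y ^ k) has_sum F x y) (UNIV \<times> UNIV)"
    if "norm x < r" "norm y < r" for x y
    using F[OF that]
    by (subst has_sum_reindex_bij_witness[where i = "\<lambda>(i, j, k). ((j, k), i)"
          and j = "\<lambda>((j, k), i). (i, j, k)" and T = UNIV
          and h = "\<lambda>(i, j, k). c i j k * a ^ i * x ^ j * y ^ k"]) auto
  have inner: "(\<lambda>i. c i j k * a ^ i) summable_on UNIV" for j k
  proof -
    define z :: complex where "z = of_real (r / 2)"
    have z: "norm z < r" "z \<noteq> 0" using r by (auto simp: z_def)
    have "(\<lambda>(u, i). c i (fst u) (snd u) * a ^ i * z ^ fst u * z ^ snd u) summable_on UNIV \<times> UNIV"
      using has_sum_imp_summable[OF swapped[OF z(1) z(1)]] by (simp add: case_prod_unfold)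
    then have "(\<lambda>i. c i (fst (j, k)) (snd (j, k)) * a ^ i * z ^ fst (j, k) * z ^ snd (j, k)) summable_on UNIV"
      by (rule summable_on_SigmaD1) simp
    then show ?thesis
      using z by (simp add: summable_on_cmult_left')
  qed
  show ?thesis
    by (rule has_sum_SigmaD[OF swapped[OF x y]])
      (auto intro!: has_sum_cmult_left has_sum_infsum inner)
qed

section \<open>The functional equation determines the homogeneous parts\<close>

text \<open>
  Each function value in the equation is a double series whose coefficients are those of \<open>F\<close>
  times powers of \<open>q\<close>, so the difference of the two sides is a vanishing double power series.  Its
  coefficient of \<open>x\<^sup>j\<^sup>+\<^sup>1 y\<^sup>k\<^sup>+\<^sup>1\<close> is the recurrence: because of the outer factors \<open>x\<close>
  on the left and \<open>y\<close> on the right, \<open>A\<close> enters there with indices \<open>(j, k + 1)\<close> and \<open>(j + 1, k)\<close>.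
\<close>
lemma functional_equation_imp_recurrence:
  fixes q a :: complex
  assumes q: "norm q < 1" and s: "s > 0"
    and F: "\<And>x y. norm x < s \<Longrightarrow> norm y < s \<Longrightarrow>
              ((\<lambda>(j, k). A j k * x ^ j * y ^ k) has_sum F x y) UNIV"
    and eq: "\<And>x y. norm x < s \<Longrightarrow> norm y < s \<Longrightarrow>
               x * (F x y - F x (q * y)) =
                 y * (F (q * x) (q * y) - F x (q * y))
                 - a * y * (F (q * x) (q\<^sup>2 * y) - F x (q\<^sup>2 * y))"
  shows "A j (Suc k) * (1 - q ^ Suc k) =
           A (Suc j) k * q ^ k * (q ^ Suc j - 1) * (1 - a * q ^ k)"
proof -
  define L where "L = (\<lambda>j k. A j k * (1 - q ^ k))"
  define R where "R = (\<lambda>j k. A j k * q ^ k * (q ^ j - 1) * (1 - a * q ^ k))"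
  define B where "B = (\<lambda>j k. (case j of 0 \<Rightarrow> 0 | Suc i \<Rightarrow> L i k) - (case k of 0 \<Rightarrow> 0 | Suc i \<Rightarrow> R j i))"
  have "B (Suc j) (Suc k) = 0"
  proof (rule double_power_series_zero[OF s])
    fix x y :: complex assume x: "norm x < s" and y: "norm y < s"
    have shrink: "norm (q * z) < s" if "norm z < s" for z
      using that q mult_left_le_one_le[of "norm z" "norm q"] by (simp add: norm_mult)
    have qx: "norm (q * x) < s" and qy: "norm (q * y) < s" and qqy: "norm (q\<^sup>2 * y) < s"
      using shrink x y shrink[OF shrink[OF y]] by (auto simp: power2_eq_square mult.assoc)
    have "((\<lambda>p. (case p of (j, k) \<Rightarrow> A j k * x ^ j * y ^ k) - (case p of (j, k) \<Rightarrow> A j k * x ^ j * (q * y) ^ k))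
            has_sum F x y - F x (q * y)) UNIV"
      by (intro has_sum_diff F x y qy)
    then have L: "((\<lambda>(j, k). L j k * x ^ j * y ^ k) has_sum F x y - F x (q * y)) UNIV"
      by (simp add: L_def case_prod_unfold power_mult_distrib algebra_simps)
    have "((\<lambda>p. ((case p of (j, k) \<Rightarrow> A j k * (q * x) ^ j * (q * y) ^ k)
                   - (case p of (j, k) \<Rightarrow> A j k * x ^ j * (q * y) ^ k))
               - a * ((case p of (j, k) \<Rightarrow> A j k * (q * x) ^ j * (q\<^sup>2 * y) ^ k)
                   - (case p of (j, k) \<Rightarrow> A j k * x ^ j * (q\<^sup>2 * y) ^ k)))
            has_sum (F (q * x) (q * y) - F x (q * y)) - a * (F (q * x) (q\<^sup>2 * y) - F x (q\<^sup>2 * y))) UNIV"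
      by (intro has_sum_diff has_sum_cmult_right F x qx qy qqy)
    then have R: "((\<lambda>(j, k). R j k * x ^ j * y ^ k) has_sum
        (F (q * x) (q * y) - F x (q * y)) - a * (F (q * x) (q\<^sup>2 * y) - F x (q\<^sup>2 * y))) UNIV"
      by (simp add: R_def case_prod_unfold power_mult_distrib power2_eq_square algebra_simps)
    have "((\<lambda>(j, k). B j k * x ^ j * y ^ k) has_sum x * (F x y - F x (q * y)) -
        y * ((F (q * x) (q * y) - F x (q * y)) - a * (F (q * x) (q\<^sup>2 * y) - F x (q\<^sup>2 * y)))) UNIV"
      using has_sum_diff[OF has_sum_times_x[OF L] has_sum_times_y[OF R]]
      by (simp add: B_def case_prod_unfold left_diff_distrib)
    then show "((\<lambda>(j, k). B j k * x ^ j * y ^ k) has_sum 0) UNIV"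
      unfolding eq[OF x y] by (simp add: algebra_simps)
  qed
  then show ?thesis by (simp add: B_def L_def R_def)
qed

text \<open>
  Each step of the recurrence moves along the antidiagonal \<open>j + k = n\<close>, hence ends at \<open>(n, 0)\<close>; the
  step can be solved for the new coefficient because no power \<open>q ^ (k + 1)\<close> is \<open>1\<close>.
\<close>
lemma recurrence_imp_cauchy_coeff:
  assumes q: "norm q < 1"
    and rec: "\<And>j k. A j (Suc k) * (1 - q ^ Suc k) =
                A (Suc j) k * q ^ k * (q ^ Suc j - 1) * (1 - a * q ^ k)"
  shows "A j k = A (j + k) 0 * cauchy_coeff q a (j + k) k"
proof (induction k arbitrary: j)
  case 0
  then show ?case by (simp add: cauchy_coeff_0[OF q])
next
  case (Suc k)
  have "A j (Suc k) * (1 - q ^ Suc k) =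
          A (Suc (j + k)) 0 * (cauchy_coeff q a (Suc (j + k)) k * q ^ k * (q ^ Suc j - 1) * (1 - a * q ^ k))"
    using rec[of j k] Suc.IH[of "Suc j"] by simp
  also have "\<dots> = A (Suc (j + k)) 0 * cauchy_coeff q a (Suc (j + k)) (Suc k) * (1 - q ^ Suc k)"
    by (simp only: cauchy_coeff_Suc[OF q] mult.assoc)
  finally show ?case
    using one_minus_power_Suc_nonzero[OF q, of k] by simp
qed

lemma functional_equation_imp_cauchy_expansion:
  fixes q a :: complex
  assumes q: "norm q < 1" and s: "s > 0"
    and F: "\<And>x y. norm x < s \<Longrightarrow> norm y < s \<Longrightarrow>
              ((\<lambda>(j, k). A j k * x ^ j * y ^ k) has_sum F x y) UNIV"
    and eq: "\<And>x y. norm x < s \<Longrightarrow> norm y < s \<Longrightarrow>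
               x * (F x y - F x (q * y)) =
                 y * (F (q * x) (q * y) - F x (q * y))
                 - a * y * (F (q * x) (q\<^sup>2 * y) - F x (q\<^sup>2 * y))"
    and x: "norm x < s" and y: "norm y < s"
  shows "(\<lambda>n. A n 0 * gen_cauchy_poly q n x y a) sums F x y"
proof -
  have coeff: "A j k = A (j + k) 0 * cauchy_coeff q a (j + k) k" for j k
    by (rule recurrence_imp_cauchy_coeff[OF q functional_equation_imp_recurrence[OF q s F eq]])
  have "(\<Sum>k\<le>n. A (n - k) k * x ^ (n - k) * y ^ k) = A n 0 * gen_cauchy_poly q n x y a" for n
    unfolding gen_cauchy_poly_eq sum_distrib_left
  proof (intro sum.cong refl)
    fix k assume "k \<in> {..n}"
    then have "A (n - k) k = A n 0 * cauchy_coeff q a n k"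
      using coeff[of "n - k" k] by simp
    then show "A (n - k) k * x ^ (n - k) * y ^ k = A n 0 * (cauchy_coeff q a n k * x ^ (n - k) * y ^ k)"
      by simp
  qed
  then show ?thesis
    using has_sum_group_by_degree[OF F[OF x y]] by simp
qed

section \<open>The expansion theorem\<close>

lemma eventually_nhds_zero3:
  fixes P :: "complex \<Rightarrow> complex \<Rightarrow> complex \<Rightarrow> bool"
  shows "(\<forall>\<^sub>F (a, x, y) in nhds (0, 0, 0). P a x y) \<longleftrightarrow>
           (\<exists>s>0. \<forall>a x y. norm a < s \<longrightarrow> norm x < s \<longrightarrow> norm y < s \<longrightarrow> P a x y)"
proof
  assume "\<forall>\<^sub>F (a, x, y) in nhds (0, 0, 0). P a x y"
  then obtain d where "d > 0" and d: "\<And>a x y. dist (a, x, y) (0, 0, 0) < d \<Longrightarrow> P a x y"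
    unfolding eventually_nhds_metric by auto
  have "P a x y" if "norm a < d / 3" "norm x < d / 3" "norm y < d / 3" for a x y
  proof (rule d)
    have "dist (a, x, y) (0, 0, 0) = norm (a, x, y)"
      by (simp add: dist_norm)
    also have "\<dots> \<le> norm a + (norm x + norm y)"
      by (intro norm_Pair_le[THEN order_trans] add_left_mono norm_Pair_le)
    finally show "dist (a, x, y) (0, 0, 0) < d" using that by simp
  qed
  then show "\<exists>s>0. \<forall>a x y. norm a < s \<longrightarrow> norm x < s \<longrightarrow> norm y < s \<longrightarrow> P a x y"
    using \<open>d > 0\<close> by (intro exI[of _ "d / 3"]) auto
next
  assume "\<exists>s>0. \<forall>a x y. norm a < s \<longrightarrow> norm x < s \<longrightarrow> norm y < s \<longrightarrow> P a x y"
  then obtain s where "s > 0"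
    and s: "\<And>a x y. norm a < s \<Longrightarrow> norm x < s \<Longrightarrow> norm y < s \<Longrightarrow> P a x y" by blast
  have "P a x y" if "dist (a, x, y) (0, 0, 0) < s" for a x y
  proof (rule s)
    have n: "norm (a, x, y) < s"
      using that by (simp add: dist_norm)
    have "norm a \<le> norm (a, x, y)" "norm (x, y) \<le> norm (a, x, y)"
      "norm x \<le> norm (x, y)" "norm y \<le> norm (x, y)"
      using norm_fst_le[of a "(x, y)"] norm_snd_le[of "(x, y)" a] norm_fst_le[of x y] norm_snd_le[of y x]
      by auto
    then show "norm a < s" "norm x < s" "norm y < s" using n by auto
  qed
  then show "\<forall>\<^sub>F (a, x, y) in nhds (0, 0, 0). P a x y"
    unfolding eventually_nhds_metric using \<open>s > 0\<close> by (intro exI[of _ s]) auto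
qed

text \<open>
  Since \<open>norm q < 1\<close>, all points at which the equation evaluates \<open>F\<close> stay in the polydisc of
  convergence, and they share the coefficients \<open>m n\<close>.
\<close>
lemma cauchy_expansion_imp_functional_equation:
  fixes q a :: complex
  assumes q: "norm q < 1"
    and F: "\<And>x y. norm x < s \<Longrightarrow> norm y < s \<Longrightarrow> (\<lambda>n. m n * gen_cauchy_poly q n x y a) sums F x y"
    and x: "norm x < s" and y: "norm y < s"
  shows "x * (F x y - F x (q * y)) =
           y * (F (q * x) (q * y) - F x (q * y))
           - a * y * (F (q * x) (q\<^sup>2 * y) - F x (q\<^sup>2 * y))"
proof -
  have shrink: "norm (q * z) < s" if "norm z < s" for z
    using that q mult_left_le_one_le[of "norm z" "norm q"] by (simp add: norm_mult)
  have qx: "norm (q * x) < s" and qy: "norm (q * y) < s" and qqy: "norm (q\<^sup>2 * y) < s"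
    using shrink x y shrink[OF shrink[OF y]] by (auto simp: power2_eq_square mult.assoc)
  let ?p = "\<lambda>n x y. gen_cauchy_poly q n x y a"
  have L: "(\<lambda>n. x * (m n * ?p n x y - m n * ?p n x (q * y))) sums (x * (F x y - F x (q * y)))"
    by (intro sums_mult sums_diff F x y qy)
  have R: "(\<lambda>n. y * (m n * ?p n (q * x) (q * y) - m n * ?p n x (q * y))
              - a * y * (m n * ?p n (q * x) (q\<^sup>2 * y) - m n * ?p n x (q\<^sup>2 * y)))
          sums (y * (F (q * x) (q * y) - F x (q * y)) - a * y * (F (q * x) (q\<^sup>2 * y) - F x (q\<^sup>2 * y)))"
    by (intro sums_mult sums_diff F x qx qy qqy)
  have "x * (m n * ?p n x y - m n * ?p n x (q * y)) =
          y * (m n * ?p n (q * x) (q * y) - m n * ?p n x (q * y))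
              - a * y * (m n * ?p n (q * x) (q\<^sup>2 * y) - m n * ?p n x (q\<^sup>2 * y))" for n
    using arg_cong[OF gen_cauchy_poly_functional_equation[OF q, of x n y a], of "\<lambda>t. m n * t"]
    by (simp add: algebra_simps)
  then show ?thesis
    using sums_unique2[OF L] R by simp
qed

theorem theorem2p1:
  fixes q :: complex
    and f :: "complex \<times> complex \<times> complex \<Rightarrow> complex"
    and U :: "(complex \<times> complex \<times> complex) set"
  assumes "norm q < 1"
    and "open U" and "(0, 0, 0) \<in> U" and "analytic3_on f U"
  shows "(\<exists>\<mu> :: nat \<Rightarrow> complex \<Rightarrow> complex.
            \<forall>\<^sub>F (a, x, y) in nhds (0, 0, 0).
              (\<lambda>n. \<mu> n a * gen_cauchy_poly q n x y a) sums f (a, x, y)) \<longleftrightarrow>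
         (\<forall>\<^sub>F (a, x, y) in nhds (0, 0, 0).
            x * (f (a, x, y) - f (a, x, q * y)) =
              y * (f (a, q * x, q * y) - f (a, x, q * y))
              - a * y * (f (a, q * x, q\<^sup>2 * y) - f (a, x, q\<^sup>2 * y)))"
  (is "?expansion \<longleftrightarrow> ?equation")
proof
  assume ?expansion
  then obtain \<mu> s where "s > 0"
    and sums: "\<And>a x y. norm a < s \<Longrightarrow> norm x < s \<Longrightarrow> norm y < s \<Longrightarrow>
                 (\<lambda>n. \<mu> n a * gen_cauchy_poly q n x y a) sums f (a, x, y)"
    unfolding eventually_nhds_zero3 by blast
  show ?equation
    unfolding eventually_nhds_zero3
  proof (intro exI[of _ s] conjI allI impI \<open>s > 0\<close>)
    fix a x y :: complex assume a: "norm a < s" and xy: "norm x < s" "norm y < s"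
    show "x * (f (a, x, y) - f (a, x, q * y)) =
            y * (f (a, q * x, q * y) - f (a, x, q * y))
            - a * y * (f (a, q * x, q\<^sup>2 * y) - f (a, x, q\<^sup>2 * y))"
      by (rule cauchy_expansion_imp_functional_equation
          [OF assms(1), of s "\<lambda>n. \<mu> n a" a "\<lambda>x y. f (a, x, y)", OF sums[OF a] xy])
  qed
next
  assume ?equation
  then obtain s where s: "s > 0"
    and eq: "\<And>a x y. norm a < s \<Longrightarrow> norm x < s \<Longrightarrow> norm y < s \<Longrightarrow>
            x * (f (a, x, y) - f (a, x, q * y)) =
              y * (f (a, q * x, q * y) - f (a, x, q * y))
              - a * y * (f (a, q * x, q\<^sup>2 * y) - f (a, x, q\<^sup>2 * y))"
    unfolding eventually_nhds_zero3 by blast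
  from assms(3,4) obtain c r where r: "r > 0"
    and series: "\<And>a x y. norm a < r \<Longrightarrow> norm x < r \<Longrightarrow> norm y < r \<Longrightarrow>
           ((\<lambda>(i, j, k). c i j k * a ^ i * x ^ j * y ^ k) has_sum f (a, x, y)) UNIV"
    unfolding analytic3_on_def by fastforce
  \<comment> \<open>On the polydisc of radius \<open>t\<close> both the power series and the functional equation are available.\<close>
  define t where "t = min r s"
  define A where "A = (\<lambda>a j k. infsum (\<lambda>i. c i j k * a ^ i) UNIV)"
  have t: "t > 0" using r s by (simp add: t_def)
  show ?expansion
    unfolding eventually_nhds_zero3
  proof (intro exI[of _ "\<lambda>n a. A a n 0"] exI[of _ t] conjI allI impI t)
    fix a x y :: complex assume a: "norm a < t" and xy: "norm x < t" "norm y < t"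
    show "(\<lambda>n. A a n 0 * gen_cauchy_poly q n x y a) sums f (a, x, y)"
    proof (rule functional_equation_imp_cauchy_expansion[OF assms(1) t _ _ xy])
      fix x y :: complex assume xy: "norm x < t" "norm y < t"
      show "((\<lambda>(j, k). A a j k * x ^ j * y ^ k) has_sum f (a, x, y)) UNIV"
        unfolding A_def
        by (rule triple_power_series_slice[OF r, of a c "\<lambda>x y. f (a, x, y)"])
          (use a xy series in \<open>auto simp: t_def\<close>)
      show "x * (f (a, x, y) - f (a, x, q * y)) =
              y * (f (a, q * x, q * y) - f (a, x, q * y))
              - a * y * (f (a, q * x, q\<^sup>2 * y) - f (a, x, q\<^sup>2 * y))"
        using eq a xy by (simp add: t_def)
    qed
  qed
qed

end
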